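(* Let $\alpha\in\mathbb Z\setminus\{0,1\}$, put $\gamma=\alpha^2-\alpha+1$, and let $(h_n)$ be the sequence with $h_0=0$, $h_1=1$, $h_2=-\alpha^2(\alpha-1)\gamma$, $h_3=-\alpha^6(\alpha-1)^3\gamma^3$, $h_4=\alpha^{12}(\alpha-1)^6\gamma^5$, and for $m\ge2$: $h_{2m+1}=h_{m+2}h_m^3-h_{m-1}h_{m+1}^3$, for $m\ge 3$: $h_{2m}=h_m\big(h_{m+2}h_{m-1}^2-h_{m-2}h_{m+1}^2\big)/h_2$. If $n\equiv 2,3,4,6,7,8,10,11,12,14,15,16\pmod{18}$, then $h_n$ is not a square.
   Context: The sequence defined is the elliptic divisibility sequence attached to the point $(0,0)$ of order $9$ on the Tate normal form curve with $c=\alpha^2(\alpha-1)$, $b=c(\alpha(\alpha-1)+1)$. Convention: an integer $m$ is called a square if $m=\pm\beta^2$ for some nonzero integer $\beta$. *)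

theory Defs
  imports Complex_Main
begin

definition pm_square :: "int \<Rightarrow> bool" where
  "pm_square m \<longleftrightarrow> (\<exists>\<beta>::int. \<beta> \<noteq> 0 \<and> (m = \<beta>\<^sup>2 \<or> m = - (\<beta>\<^sup>2)))"

(* For \<alpha> other than 0 and 1 the integer division is exact: see eds9_even below. *)

function eds9 :: "int \<Rightarrow> nat \<Rightarrow> int" where
  "eds9 \<alpha> n =
    (let \<gamma> = \<alpha>\<^sup>2 - \<alpha> + 1; m = n div 2 in
     if n = 0 then 0
     else if n = 1 then 1
     else if n = 2 then - (\<alpha>\<^sup>2 * (\<alpha> - 1) * \<gamma>)
     else if n = 3 then - (\<alpha>^6 * (\<alpha> - 1)^3 * \<gamma>^3)
     else if n = 4 then \<alpha>^12 * (\<alpha> - 1)^6 * \<gamma>^5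
     else if odd n then
       eds9 \<alpha> (m + 2) * eds9 \<alpha> m ^ 3 - eds9 \<alpha> (m - 1) * eds9 \<alpha> (m + 1) ^ 3
     else
       eds9 \<alpha> m * (eds9 \<alpha> (m + 2) * (eds9 \<alpha> (m - 1))\<^sup>2 - eds9 \<alpha> (m - 2) * (eds9 \<alpha> (m + 1))\<^sup>2)
         div eds9 \<alpha> 2)"
  by pat_completeness auto
termination
  by (relation "measure snd") (auto elim!: oddE evenE)

declare eds9.simps [simp del]

lemma eds9_0: "eds9 \<alpha> 0 = 0"
  and eds9_1: "eds9 \<alpha> 1 = 1"
  and eds9_2: "eds9 \<alpha> 2 = - (\<alpha>\<^sup>2 * (\<alpha> - 1) * (\<alpha>\<^sup>2 - \<alpha> + 1))"
  and eds9_3: "eds9 \<alpha> 3 = - (\<alpha>^6 * (\<alpha> - 1)^3 * (\<alpha>\<^sup>2 - \<alpha> + 1)^3)"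
  and eds9_4: "eds9 \<alpha> 4 = \<alpha>^12 * (\<alpha> - 1)^6 * (\<alpha>\<^sup>2 - \<alpha> + 1)^5"
  by (subst eds9.simps, simp add: Let_def)+

lemma eds9_odd:
  assumes "2 \<le> m"
  shows "eds9 \<alpha> (2 * m + 1) =
    eds9 \<alpha> (m + 2) * eds9 \<alpha> m ^ 3 - eds9 \<alpha> (m - 1) * eds9 \<alpha> (m + 1) ^ 3"
proof -
  have "2 * m + 1 \<noteq> 0" "2 * m + 1 \<noteq> 1" "2 * m + 1 \<noteq> 2" "2 * m + 1 \<noteq> 3" "2 * m + 1 \<noteq> 4"
    using assms by presburger+
  moreover have "(2 * m + 1) div 2 = m" "odd (2 * m + 1)" by simp_all
  ultimately show ?thesis by (subst eds9.simps) (simp only: Let_def if_False if_True simp_thms)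
qed

lemma eds9_even_div:
  assumes "3 \<le> m"
  shows "eds9 \<alpha> (2 * m) =
    eds9 \<alpha> m * (eds9 \<alpha> (m + 2) * (eds9 \<alpha> (m - 1))\<^sup>2 - eds9 \<alpha> (m - 2) * (eds9 \<alpha> (m + 1))\<^sup>2)
      div eds9 \<alpha> 2"
proof -
  have "2 * m \<noteq> 0" "2 * m \<noteq> 1" "2 * m \<noteq> 2" "2 * m \<noteq> 3" "2 * m \<noteq> 4"
    using assms by presburger+
  moreover have "(2 * m) div 2 = m" "\<not> odd (2 * m)" by simp_all
  ultimately show ?thesis by (subst eds9.simps) (simp only: Let_def if_False if_True simp_thms)
qed

(* Closed form of the sequence, with a = \<alpha>, b = \<alpha> - 1, g = \<alpha>^2 - \<alpha> + 1. *)

definition mono3 :: "int \<Rightarrow> int \<Rightarrow> int \<Rightarrow> nat \<Rightarrow> nat \<Rightarrow> nat \<Rightarrow> int" where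
  "mono3 a b g e f k = a ^ e * b ^ f * g ^ k"

lemma mono3_mult: "mono3 a b g e f k * mono3 a b g e' f' k' = mono3 a b g (e + e') (f + f') (k + k')"
  by (simp add: mono3_def power_add)

lemma mono3_power: "mono3 a b g e f k ^ n = mono3 a b g (e * n) (f * n) (k * n)"
  by (simp add: mono3_def power_mult power_mult_distrib)

definition eds9_closed :: "int \<Rightarrow> int \<Rightarrow> int \<Rightarrow> nat \<Rightarrow> int" where
  "eds9_closed a b g n = (let q = n div 9; r = n mod 9; M = mono3 a b g in
     (- 1) ^ q * M 63 36 27 ^ (q * q) * M 14 8 6 ^ (q * r) *
     [0, 1, - M 2 1 1, - M 6 3 3, M 12 6 5,
      M 19 10 8, - M 27 15 12, - M 37 21 16, M 49 28 21] ! r)"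

lemma eds9_closed_values:
  fixes a b g :: int
  defines "H \<equiv> eds9_closed a b g" and "M \<equiv> mono3 a b g"
  shows
    "H 0 = 0"
    and "H (Suc 0) = 1"
    and "H 2 = - M 2 1 1"
    and "H 3 = - M 6 3 3"
    and "H 4 = M 12 6 5"
    and "H 5 = M 19 10 8"
    and "H 6 = - M 27 15 12"
    and "H 7 = - M 37 21 16"
    and "H 8 = M 49 28 21"
    and "H 9 = 0"
    and "H 10 = - M 77 44 33"
    and "H 11 = M 93 53 40"
    and "H 12 = M 111 63 48"
    and "H 13 = - M 131 74 56"
    and "H 14 = - M 152 86 65"
    and "H 15 = M 174 99 75"
    and "H 16 = M 198 113 85"
    and "H 17 = - M 224 128 96"
    and "H 18 = 0"
    and "H 19 = M 280 160 120"
    and "H 20 = - M 310 177 133"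
    and "H 21 = - M 342 195 147"
  unfolding H_def M_def eds9_closed_def Let_def
  by (simp_all add: mono3_mult mono3_power)

lemma eds9_closed_add_9:
  "eds9_closed a b g (n + 9) =
    - mono3 a b g 63 36 27 * mono3 a b g 14 8 6 ^ n * eds9_closed a b g n"
proof -
  define w where "w = mono3 a b g 63 36 27"
  define v where "v = mono3 a b g 14 8 6"
  define q where "q = n div 9"
  define r where "r = n mod 9"
  have n: "n = 9 * q + r" by (simp add: q_def r_def)
  have d: "(n + 9) div 9 = Suc q" "(n + 9) mod 9 = r" by (simp_all add: q_def r_def)
  have vw: "v ^ 9 = w ^ 2" by (simp add: v_def w_def mono3_power)
  have "v ^ n = w ^ q * w ^ q * v ^ r"
    by (simp add: n power_add power_mult vw power2_eq_square power_mult_distrib)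
  then show ?thesis
    unfolding eds9_closed_def Let_def d q_def [symmetric] r_def [symmetric]
      w_def [symmetric] v_def [symmetric]
    by (simp add: power_add ac_simps)
qed

lemma eds9_closed_shift:
  "eds9_closed a b g (9 * q + j) =
    (- 1) ^ q * mono3 a b g 63 36 27 ^ (q * q) * mono3 a b g 14 8 6 ^ (q * j) * eds9_closed a b g j"
proof -
  define w where "w = mono3 a b g 63 36 27"
  define v where "v = mono3 a b g 14 8 6"
  have vw: "v ^ 9 = w ^ 2" by (simp add: v_def w_def mono3_power)
  have "eds9_closed a b g (9 * q + j) = (- 1) ^ q * w ^ (q * q) * v ^ (q * j) * eds9_closed a b g j"
  proof (induction q)
    case (Suc q)
    have e: "9 * Suc q + j = (9 * q + j) + 9" by simp
    have v: "v ^ (9 * q + j) = w ^ q * w ^ q * v ^ j"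
      by (simp add: power_add power_mult vw power2_eq_square power_mult_distrib)
    show ?case
      unfolding e eds9_closed_add_9 Suc w_def [symmetric] v_def [symmetric] v
      by (simp add: power_add ac_simps)
  qed simp
  then show ?thesis by (simp only: w_def v_def)
qed

lemma eds9_mono3_rel:
  assumes "b = a - 1" and "g = a\<^sup>2 - a + 1"
  shows "mono3 a b g e f (k + 1) = mono3 a b g e f k + mono3 a b g (e + 1) (f + 1) k"
    and "mono3 a b g e f (k + 1) = mono3 a b g (e + 1) f k + mono3 a b g e (f + 2) k"
    and "mono3 a b g (e + 1) f k = mono3 a b g e f k + mono3 a b g e (f + 1) k"
proof -
  define A where "A = mono3 a b g e f k"
  have g: "mono3 a b g e f (k + 1) = A * g"
    and a: "mono3 a b g (e + 1) f k = A * a"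
    and b: "mono3 a b g e (f + 1) k = A * b"
    and bb: "mono3 a b g e (f + 2) k = A * b\<^sup>2"
    and ab: "mono3 a b g (e + 1) (f + 1) k = A * (a * b)"
    by (simp_all add: A_def mono3_def power2_eq_square)
  have rel: "g = 1 + a * b" "g = a + b\<^sup>2" "a = 1 + b"
    using assms by algebra+
  show "mono3 a b g e f (k + 1) = mono3 a b g e f k + mono3 a b g (e + 1) (f + 1) k"
    unfolding g ab A_def [symmetric] using rel(1) by algebra
  show "mono3 a b g e f (k + 1) = mono3 a b g (e + 1) f k + mono3 a b g e (f + 2) k"
    unfolding g a bb using rel(2) by algebra
  show "mono3 a b g (e + 1) f k = mono3 a b g e f k + mono3 a b g e (f + 1) k"
    unfolding a b A_def [symmetric] using rel(3) by algebra
qed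

lemma eds9_closed_odd_base:
  fixes a b g :: int
  defines "H \<equiv> eds9_closed a b g"
  assumes "b = a - 1" and "g = a\<^sup>2 - a + 1" and "r \<in> {2..10}"
  shows "H (2 * r + 1) = H (r + 2) * H r ^ 3 - H (r - 1) * H (r + 1) ^ 3"
proof -
  define M where "M = mono3 a b g"
  have M: "M e f k * M e' f' k' = M (e + e') (f + f') (k + k')"
    "M e f k ^ n = M (e * n) (f * n) (k * n)" for e f k e' f' k' n
    by (simp_all add: M_def mono3_mult mono3_power)
  note rel = eds9_mono3_rel [OF assms(2,3), folded M_def]
  note val = eds9_closed_values [of a b g, folded H_def M_def]
  have c2: "H 5 = H 4 * H 2 ^ 3 - H (Suc 0) * H 3 ^ 3"
    using rel(1) [of 18 9 8] by (simp add: val M)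
  have c3: "H 7 = H 5 * H 3 ^ 3 - H 2 * H 4 ^ 3"
    using rel(2) [of 37 19 16] by (simp add: val M)
  have c4: "H 9 = H 6 * H 4 ^ 3 - H 3 * H 5 ^ 3"
    by (simp add: val M)
  have c5: "H 11 = H 7 * H 5 ^ 3 - H 4 * H 6 ^ 3"
    using rel(2) [of 93 51 40] by (simp add: val M)
  have c6: "H 13 = H 8 * H 6 ^ 3 - H 5 * H 7 ^ 3"
    using rel(1) [of 130 73 56] by (simp add: val M)
  have c7: "H 15 = H 9 * H 7 ^ 3 - H 6 * H 8 ^ 3"
    by (simp add: val M)
  have c8: "H 17 = H 10 * H 8 ^ 3 - H 7 * H 9 ^ 3"
    by (simp add: val M)
  have c9: "H 19 = H 11 * H 9 ^ 3 - H 8 * H 10 ^ 3"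
    by (simp add: val M)
  have c10: "H 21 = H 12 * H 10 ^ 3 - H 9 * H 11 ^ 3"
    by (simp add: val M)
  have "r \<in> {2, 3, 4, 5, 6, 7, 8, 9, 10}" using assms by auto
  then show ?thesis
    by (elim insertE) (simp_all add: c2 c3 c4 c5 c6 c7 c8 c9 c10)
qed

lemma eds9_closed_even_base:
  fixes a b g :: int
  defines "H \<equiv> eds9_closed a b g"
  assumes "b = a - 1" and "g = a\<^sup>2 - a + 1" and "r \<in> {2..10}"
  shows "H 2 * H (2 * r) = H r * (H (r + 2) * (H (r - 1))\<^sup>2 - H (r - 2) * (H (r + 1))\<^sup>2)"
proof -
  define M where "M = mono3 a b g"
  have M: "M e f k * M e' f' k' = M (e + e') (f + f') (k + k')"
    "M e f k ^ n = M (e * n) (f * n) (k * n)" for e f k e' f' k' n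
    by (simp_all add: M_def mono3_mult mono3_power)
  note rel = eds9_mono3_rel [OF assms(2,3), folded M_def]
  note val = eds9_closed_values [of a b g, folded H_def M_def]
  have c2: "H 2 * H 4 = H 2 * (H 4 * (H (Suc 0))\<^sup>2 - H 0 * (H 3)\<^sup>2)"
    by (simp add: val M right_diff_distrib)
  have c3: "H 2 * H 6 = H 3 * (H 5 * (H 2)\<^sup>2 - H (Suc 0) * (H 4)\<^sup>2)"
    using rel(3) [of 29 15 13] by (simp add: val M right_diff_distrib)
  have c4: "H 2 * H 8 = H 4 * (H 6 * (H 3)\<^sup>2 - H 2 * (H 5)\<^sup>2)"
    using rel(2) [of 51 27 22] by (simp add: val M right_diff_distrib)
  have c5: "H 2 * H 10 = H 5 * (H 7 * (H 4)\<^sup>2 - H 3 * (H 6)\<^sup>2)"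
    using rel(2) [of 79 43 34] by (simp add: val M right_diff_distrib)
  have c6: "H 2 * H 12 = H 6 * (H 8 * (H 5)\<^sup>2 - H 4 * (H 7)\<^sup>2)"
    using rel(3) [of 113 63 49] by (simp add: val M right_diff_distrib)
  have c7: "H 2 * H 14 = H 7 * (H 9 * (H 6)\<^sup>2 - H 5 * (H 8)\<^sup>2)"
    by (simp add: val M right_diff_distrib)
  have c8: "H 2 * H 16 = H 8 * (H 10 * (H 7)\<^sup>2 - H 6 * (H 9)\<^sup>2)"
    by (simp add: val M right_diff_distrib)
  have c9: "H 2 * H 18 = H 9 * (H 11 * (H 8)\<^sup>2 - H 7 * (H 10)\<^sup>2)"
    by (simp add: val M right_diff_distrib)
  have c10: "H 2 * H 20 = H 10 * (H 12 * (H 9)\<^sup>2 - H 8 * (H 11)\<^sup>2)"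
    by (simp add: val M right_diff_distrib)
  have "r \<in> {2, 3, 4, 5, 6, 7, 8, 9, 10}" using assms by auto
  then show ?thesis
    by (elim insertE) (simp_all add: c2 c3 c4 c5 c6 c7 c8 c9 c10)
qed

lemma eds9_closed_odd:
  fixes a b g :: int
  defines "H \<equiv> eds9_closed a b g"
  assumes "b = a - 1" and "g = a\<^sup>2 - a + 1" and "2 \<le> m"
  shows "H (2 * m + 1) = H (m + 2) * H m ^ 3 - H (m - 1) * H (m + 1) ^ 3"
proof -
  define q where "q = (m - 2) div 9"
  define k where "k = (m - 2) mod 9"
  have "m - 2 = 9 * q + k" by (simp add: q_def k_def)
  with \<open>2 \<le> m\<close> have m: "m = 9 * q + (k + 2)" by simp
  have k: "k + 2 \<in> {2..10}" by (simp add: k_def less_Suc_eq_le [symmetric])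
  define w where "w = mono3 a b g 63 36 27"
  define v where "v = mono3 a b g 14 8 6"
  have sh: "H (9 * q + j) = (- 1) ^ q * (w ^ (q * q) * v ^ (q * j) * H j)" for q j
    unfolding H_def w_def v_def eds9_closed_shift by (simp only: mult.assoc)
  have base: "H (2 * (k + 2) + 1) =
      H (k + 2 + 2) * H (k + 2) ^ 3 - H (k + 2 - 1) * H (k + 2 + 1) ^ 3"
    unfolding H_def by (rule eds9_closed_odd_base) (use assms k in simp_all)
  have idx: "2 * m + 1 = 9 * (2 * q) + (2 * (k + 2) + 1)" "m + 2 = 9 * q + (k + 2 + 2)"
    "m - 1 = 9 * q + (k + 2 - 1)" "m + 1 = 9 * q + (k + 2 + 1)"
    using m by simp_all
  define W where "W = w ^ (4 * (q * q)) * v ^ (2 * q * (2 * (k + 2) + 1))"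
  define s :: int where "s = (- 1) ^ q"
  have sq: "s * s = 1"
    by (simp add: s_def flip: power_mult_distrib)
  have s4: "((- 1) ^ q * A) * ((- 1) ^ q * B) ^ 3 = A * B ^ 3" for A B :: int
    unfolding s_def [symmetric] using sq by algebra
  have 1: "H (2 * m + 1) = W * H (2 * (k + 2) + 1)"
    unfolding idx sh W_def by (simp add: power_mult [symmetric] ac_simps)
  have 2: "H (m + 2) * H m ^ 3 = W * (H (k + 2 + 2) * H (k + 2) ^ 3)"
  proof -
    have "H (m + 2) * H m ^ 3 = (w ^ (q * q) * v ^ (q * (k + 2 + 2)) * H (k + 2 + 2)) *
        (w ^ (q * q) * v ^ (q * (k + 2)) * H (k + 2)) ^ 3"
      by (subst idx, subst m, simp only: sh s4)
    also have "\<dots> = (w ^ (q * q) * w ^ (q * q * 3)) *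
        (v ^ (q * (k + 2 + 2)) * v ^ (q * (k + 2) * 3)) * (H (k + 2 + 2) * H (k + 2) ^ 3)"
      by (simp only: power_mult_distrib power_mult [symmetric] mult_ac)
    also have "\<dots> = W * (H (k + 2 + 2) * H (k + 2) ^ 3)"
      unfolding W_def power_add [symmetric] by (simp add: algebra_simps)
    finally show ?thesis .
  qed
  have 3: "H (m - 1) * H (m + 1) ^ 3 = W * (H (k + 2 - 1) * H (k + 2 + 1) ^ 3)"
  proof -
    have "H (m - 1) * H (m + 1) ^ 3 = (w ^ (q * q) * v ^ (q * (k + 2 - 1)) * H (k + 2 - 1)) *
        (w ^ (q * q) * v ^ (q * (k + 2 + 1)) * H (k + 2 + 1)) ^ 3"
      by (simp only: idx sh s4)
    also have "\<dots> = (w ^ (q * q) * w ^ (q * q * 3)) *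
        (v ^ (q * (k + 2 - 1)) * v ^ (q * (k + 2 + 1) * 3)) * (H (k + 2 - 1) * H (k + 2 + 1) ^ 3)"
      by (simp only: power_mult_distrib power_mult [symmetric] mult_ac)
    also have "\<dots> = W * (H (k + 2 - 1) * H (k + 2 + 1) ^ 3)"
      unfolding W_def power_add [symmetric] by (simp add: algebra_simps)
    finally show ?thesis .
  qed
  show ?thesis unfolding 1 2 3 base by (simp add: algebra_simps)
qed

lemma eds9_closed_even:
  fixes a b g :: int
  defines "H \<equiv> eds9_closed a b g"
  assumes "b = a - 1" and "g = a\<^sup>2 - a + 1" and "2 \<le> m"
  shows "H 2 * H (2 * m) = H m * (H (m + 2) * (H (m - 1))\<^sup>2 - H (m - 2) * (H (m + 1))\<^sup>2)"
proof -
  define q where "q = (m - 2) div 9"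
  define k where "k = (m - 2) mod 9"
  have "m - 2 = 9 * q + k" by (simp add: q_def k_def)
  with \<open>2 \<le> m\<close> have m: "m = 9 * q + (k + 2)" by simp
  have k: "k + 2 \<in> {2..10}" by (simp add: k_def less_Suc_eq_le [symmetric])
  define w where "w = mono3 a b g 63 36 27"
  define v where "v = mono3 a b g 14 8 6"
  have sh: "H (9 * q + j) = (- 1) ^ q * (w ^ (q * q) * v ^ (q * j) * H j)" for q j
    unfolding H_def w_def v_def eds9_closed_shift by (simp only: mult.assoc)
  have base: "H 2 * H (2 * (k + 2)) = H (k + 2) *
      (H (k + 2 + 2) * (H (k + 2 - 1))\<^sup>2 - H (k + 2 - 2) * (H (k + 2 + 1))\<^sup>2)"
    unfolding H_def by (rule eds9_closed_even_base) (use assms k in simp_all)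
  have idx: "2 * m = 9 * (2 * q) + (2 * (k + 2))" "m + 2 = 9 * q + (k + 2 + 2)"
    "m - 1 = 9 * q + (k + 2 - 1)" "m + 1 = 9 * q + (k + 2 + 1)" "m - 2 = 9 * q + (k + 2 - 2)"
    using m by simp_all
  define W where "W = w ^ (4 * (q * q)) * v ^ (2 * q * (2 * (k + 2)))"
  define s :: int where "s = (- 1) ^ q"
  have sq: "s * s = 1"
    by (simp add: s_def flip: power_mult_distrib)
  have s4: "((- 1) ^ q * C) * (((- 1) ^ q * A) * ((- 1) ^ q * B)\<^sup>2) = C * (A * B\<^sup>2)" for A B C :: int
    unfolding s_def [symmetric] using sq by algebra
  have 1: "H (2 * m) = W * H (2 * (k + 2))"
    unfolding idx sh W_def by (simp add: power_mult [symmetric] ac_simps)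
  have gen: "H m * (H (9 * q + i) * (H (9 * q + j))\<^sup>2) = W * (H (k + 2) * (H i * (H j)\<^sup>2))"
    if ij: "k + 2 + i + 2 * j = 4 * (k + 2)" for i j
  proof -
    have "H m * (H (9 * q + i) * (H (9 * q + j))\<^sup>2) = (w ^ (q * q) * v ^ (q * (k + 2)) * H (k + 2)) *
        ((w ^ (q * q) * v ^ (q * i) * H i) * (w ^ (q * q) * v ^ (q * j) * H j)\<^sup>2)"
      by (subst m, simp only: sh s4)
    also have "\<dots> = (w ^ (q * q) * w ^ (q * q) * w ^ (q * q * 2)) *
        (v ^ (q * (k + 2)) * v ^ (q * i) * v ^ (q * j * 2)) * (H (k + 2) * (H i * (H j)\<^sup>2))"
      by (simp only: power_mult_distrib power_mult [symmetric] mult_ac)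
    also have "v ^ (q * (k + 2)) * v ^ (q * i) * v ^ (q * j * 2) = v ^ (2 * q * (2 * (k + 2)))"
    proof -
      have "q * (k + 2) + q * i + q * j * 2 = q * (k + 2 + i + 2 * j)"
        by (simp add: algebra_simps)
      also have "\<dots> = 2 * q * (2 * (k + 2))" unfolding ij by (simp only: mult_2 algebra_simps)
      finally show ?thesis by (simp only: power_add [symmetric])
    qed
    also have "w ^ (q * q) * w ^ (q * q) * w ^ (q * q * 2) = w ^ (4 * (q * q))"
      unfolding power_add [symmetric] by (simp add: ac_simps)
    finally show ?thesis by (simp only: W_def)
  qed
  have 2: "H m * (H (m + 2) * (H (m - 1))\<^sup>2) = W * (H (k + 2) * (H (k + 2 + 2) * (H (k + 2 - 1))\<^sup>2))"
    unfolding idx by (rule gen) simp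
  have 3: "H m * (H (m - 2) * (H (m + 1))\<^sup>2) = W * (H (k + 2) * (H (k + 2 - 2) * (H (k + 2 + 1))\<^sup>2))"
    unfolding idx by (rule gen) simp
  have "H 2 * H (2 * m) = W * (H 2 * H (2 * (k + 2)))" unfolding 1 by (rule mult.left_commute)
  also have "\<dots> = H m * (H (m + 2) * (H (m - 1))\<^sup>2) - H m * (H (m - 2) * (H (m + 1))\<^sup>2)"
    unfolding base 2 3 by (simp only: right_diff_distrib)
  finally show ?thesis by (simp only: right_diff_distrib)
qed

lemma eds9_2_nonzero:
  assumes "\<alpha> \<notin> {0, 1}"
  shows "eds9 \<alpha> 2 \<noteq> 0"
proof -
  have "odd (\<alpha>\<^sup>2 - \<alpha> + 1)" by simp
  then have "\<alpha>\<^sup>2 - \<alpha> + 1 \<noteq> 0" by (metis even_zero)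
  then show ?thesis using assms by (simp add: eds9_2)
qed

lemma eds9_eq_closed:
  assumes "\<alpha> \<notin> {0, 1}"
  shows "eds9 \<alpha> n = eds9_closed \<alpha> (\<alpha> - 1) (\<alpha>\<^sup>2 - \<alpha> + 1) n"
proof (induction n rule: less_induct)
  case (less n)
  let ?H = "eds9_closed \<alpha> (\<alpha> - 1) (\<alpha>\<^sup>2 - \<alpha> + 1)"
  have val: "eds9 \<alpha> 2 = ?H 2"
    by (simp add: eds9_2 eds9_closed_values mono3_def)
  consider "n \<in> {0, 1, 2, 3, 4}" | m where "2 \<le> m" "n = 2 * m + 1" | m where "3 \<le> m" "n = 2 * m"
  proof -
    have "n \<le> 4 \<or> (n = 2 * (n div 2) + 1 \<and> 2 \<le> n div 2) \<or> (n = 2 * (n div 2) \<and> 3 \<le> n div 2)"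
      by presburger
    moreover have "n \<in> {0, 1, 2, 3, 4}" if "n \<le> 4" using that by auto
    ultimately show ?thesis using that by blast
  qed
  then show ?case
  proof cases
    case 1
    then show ?thesis
      using eds9_1 [of \<alpha>] by (auto simp: eds9_0 eds9_2 eds9_3 eds9_4 eds9_closed_values mono3_def)
  next
    case (2 m)
    then have "eds9 \<alpha> (m + 2) = ?H (m + 2)" "eds9 \<alpha> m = ?H m"
      "eds9 \<alpha> (m - 1) = ?H (m - 1)" "eds9 \<alpha> (m + 1) = ?H (m + 1)"
      by (simp_all add: less)
    then show ?thesis
      unfolding 2 eds9_odd [OF \<open>2 \<le> m\<close>] by (simp only: eds9_closed_odd [OF refl refl \<open>2 \<le> m\<close>])
  next
    case (3 m)
    then have "2 \<le> m" by simp
    from 3 have "eds9 \<alpha> (m + 2) = ?H (m + 2)" "eds9 \<alpha> m = ?H m" "eds9 \<alpha> (m - 2) = ?H (m - 2)"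
      "eds9 \<alpha> (m - 1) = ?H (m - 1)" "eds9 \<alpha> (m + 1) = ?H (m + 1)"
      by (simp_all add: less)
    then have "eds9 \<alpha> (2 * m) = ?H 2 * ?H (2 * m) div ?H 2"
      unfolding eds9_even_div [OF \<open>3 \<le> m\<close>] val
      by (simp only: eds9_closed_even [OF refl refl \<open>2 \<le> m\<close>])
    moreover have "?H 2 \<noteq> 0" using eds9_2_nonzero [OF assms] val by simp
    ultimately show ?thesis unfolding 3 by simp
  qed
qed

theorem eds9_even:
  assumes "\<alpha> \<notin> {0, 1}" and "3 \<le> m"
  shows "eds9 \<alpha> 2 dvd
      eds9 \<alpha> m * (eds9 \<alpha> (m + 2) * (eds9 \<alpha> (m - 1))\<^sup>2 - eds9 \<alpha> (m - 2) * (eds9 \<alpha> (m + 1))\<^sup>2)"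
    and "(of_int (eds9 \<alpha> (2 * m)) :: rat) =
      of_int (eds9 \<alpha> m * (eds9 \<alpha> (m + 2) * (eds9 \<alpha> (m - 1))\<^sup>2 - eds9 \<alpha> (m - 2) * (eds9 \<alpha> (m + 1))\<^sup>2))
        / of_int (eds9 \<alpha> 2)"
proof -
  have "2 \<le> m" using assms by simp
  then have eq: "eds9 \<alpha> 2 * eds9 \<alpha> (2 * m) =
      eds9 \<alpha> m * (eds9 \<alpha> (m + 2) * (eds9 \<alpha> (m - 1))\<^sup>2 - eds9 \<alpha> (m - 2) * (eds9 \<alpha> (m + 1))\<^sup>2)"
    unfolding eds9_eq_closed [OF assms(1)] by (rule eds9_closed_even [OF refl refl])
  then show "eds9 \<alpha> 2 dvd
      eds9 \<alpha> m * (eds9 \<alpha> (m + 2) * (eds9 \<alpha> (m - 1))\<^sup>2 - eds9 \<alpha> (m - 2) * (eds9 \<alpha> (m + 1))\<^sup>2)"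
    by (metis dvd_triv_left)
  show "(of_int (eds9 \<alpha> (2 * m)) :: rat) =
      of_int (eds9 \<alpha> m * (eds9 \<alpha> (m + 2) * (eds9 \<alpha> (m - 1))\<^sup>2 - eds9 \<alpha> (m - 2) * (eds9 \<alpha> (m + 1))\<^sup>2))
        / of_int (eds9 \<alpha> 2)"
    unfolding eq [symmetric] using eds9_2_nonzero [OF assms(1)] by simp
qed

end

theory Submission
  imports Defs "HOL-Computational_Algebra.Nth_Powers"
begin

text \<open>
  By the closed form, up to sign and a square factor \<open>h\<^sub>n\<close> depends only on \<open>n mod 18\<close>, and for the
  residues in question it is one of \<open>\<gamma>\<close>, \<open>\<alpha>(\<alpha> - 1)\<close>, \<open>\<alpha>\<gamma>\<close>, \<open>(\<alpha> - 1)\<gamma>\<close>. The first two lie strictly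
  between the consecutive squares of \<open>\<alpha> - 1\<close> and \<open>\<alpha>\<close>. Since \<open>\<gamma>\<close> is coprime to \<open>\<alpha>\<close> and to \<open>\<alpha> - 1\<close>,
  if one of the last two were a square up to sign, then so would be \<open>\<gamma>\<close>.
\<close>

lemma pm_square_minus [simp]: "pm_square (- m) \<longleftrightarrow> pm_square m"
  by (auto simp: pm_square_def)

lemma pm_square_mult_square:
  assumes "c \<noteq> 0"
  shows "pm_square (c\<^sup>2 * m) \<longleftrightarrow> pm_square m"
proof
  assume "pm_square (c\<^sup>2 * m)"
  then obtain \<beta> where \<beta>: "\<beta> \<noteq> 0" "c\<^sup>2 * m = \<beta>\<^sup>2 \<or> c\<^sup>2 * m = - (\<beta>\<^sup>2)"
    by (auto simp: pm_square_def)
  then have "c\<^sup>2 dvd \<beta>\<^sup>2"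
    by (metis dvd_minus_iff dvd_triv_left)
  \<comment> \<open>Divisibility between squares descends to their roots:
    \<open>c dvd \<beta>\<close>.\<close>
  then obtain d where d: "\<beta> = c * d"
    by (auto elim: dvdE)
  from \<beta>(2) have "c\<^sup>2 * m = c\<^sup>2 * d\<^sup>2 \<or> c\<^sup>2 * m = c\<^sup>2 * - (d\<^sup>2)"
    by (simp add: d power_mult_distrib)
  then have "m = d\<^sup>2 \<or> m = - (d\<^sup>2)"
    using assms by (simp only: mult_cancel_left) simp
  then show "pm_square m"
    using \<beta>(1) d by (auto simp: pm_square_def)
next
  assume "pm_square m"
  then obtain \<beta> where \<beta>: "\<beta> \<noteq> 0" "m = \<beta>\<^sup>2 \<or> m = - (\<beta>\<^sup>2)"
    by (auto simp: pm_square_def)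
  then have "c * \<beta> \<noteq> 0" "c\<^sup>2 * m = (c * \<beta>)\<^sup>2 \<or> c\<^sup>2 * m = - ((c * \<beta>)\<^sup>2)"
    using assms by (auto simp: power_mult_distrib)
  then show "pm_square (c\<^sup>2 * m)"
    unfolding pm_square_def by blast
qed

text \<open>Absolute values absorb the sign, so facts on powers in the naturals apply. Zero is
  excluded because it is itself a second power.\<close>

lemma pm_square_iff_is_nth_power:
  "pm_square m \<longleftrightarrow> m \<noteq> 0 \<and> is_nth_power 2 (nat \<bar>m\<bar>)"
proof
  assume "pm_square m"
  then obtain \<beta> where "\<beta> \<noteq> 0" "\<bar>m\<bar> = \<beta>\<^sup>2"
    by (auto simp: pm_square_def)
  then show "m \<noteq> 0 \<and> is_nth_power 2 (nat \<bar>m\<bar>)"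
    by (auto simp: is_nth_power_def nat_abs_mult_distrib power2_eq_square intro!: exI [of _ "nat \<bar>\<beta>\<bar>"]
        simp flip: nat_mult_distrib)
next
  assume m: "m \<noteq> 0 \<and> is_nth_power 2 (nat \<bar>m\<bar>)"
  then obtain k where "nat \<bar>m\<bar> = k\<^sup>2"
    by (auto simp: is_nth_power_def)
  then have k: "\<bar>m\<bar> = (int k)\<^sup>2"
    by (metis abs_ge_zero int_nat_eq of_nat_power)
  with m have "int k \<noteq> 0"
    by (metis abs_eq_0 zero_power2)
  moreover have "m = (int k)\<^sup>2 \<or> m = - ((int k)\<^sup>2)"
    using k by linarith
  ultimately show "pm_square m"
    unfolding pm_square_def by blast
qed

lemma pm_square_mult_coprimeD:
  assumes "pm_square (x * y)" and "coprime x y"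
  shows "pm_square y"
proof -
  have "coprime (nat \<bar>x\<bar>) (nat \<bar>y\<bar>)"
    using assms(2) by simp
  with assms(1) show ?thesis
    using is_nth_power_mult_coprime_natD(2) [of "nat \<bar>x\<bar>" "nat \<bar>y\<bar>" 2]
    by (simp add: pm_square_iff_is_nth_power abs_mult nat_mult_distrib)
qed

lemma not_pm_square_between:
  assumes "0 \<le> k" and "k\<^sup>2 < m" and "m < (k + 1)\<^sup>2"
  shows "\<not> pm_square m"
proof
  assume "pm_square m"
  moreover have "0 < m"
    using assms(2) zero_le_power2 [of k] by linarith
  ultimately obtain \<beta> where "m = \<beta>\<^sup>2 \<or> m = - (\<beta>\<^sup>2)"
    by (auto simp: pm_square_def)
  with \<open>0 < m\<close> have "m = \<bar>\<beta>\<bar>\<^sup>2"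
    using zero_le_power2 [of \<beta>] by (auto simp del: zero_le_power2)
  with assms have "k < \<bar>\<beta>\<bar>" "\<bar>\<beta>\<bar> < k + 1"
    using power_less_imp_less_base [of k 2 "\<bar>\<beta>\<bar>"] power_less_imp_less_base [of "\<bar>\<beta>\<bar>" 2 "k + 1"]
    by auto
  then show False by linarith
qed

text \<open>One sandwich serves both uses: \<open>c = 1\<close> is \<gamma> and \<open>c = 0\<close>
  is \<alpha>(\<alpha> - 1).\<close>

lemma not_pm_square_consecutive:
  assumes "\<alpha> \<notin> {0, 1}" and "c \<in> {0, 1}"
  shows "\<not> pm_square (\<alpha>\<^sup>2 - \<alpha> + c)"
proof (cases "\<alpha> < 0")
  case True
  then show ?thesis
    \<comment> \<open>The lower root is the smaller of the absolute values of \<alpha> and \<alpha>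
      - 1, here \<open>- \<alpha>\<close>.\<close>
    using assms by (intro not_pm_square_between [of "- \<alpha>"]) (auto simp: power2_eq_square algebra_simps)
next
  case False
  then show ?thesis
    using assms by (intro not_pm_square_between [of "\<alpha> - 1"]) (auto simp: power2_eq_square algebra_simps)
qed

text \<open>Halving the exponents splits off the square of a monomial, so only their parities
  matter.\<close>

lemma pm_square_mono3:
  assumes "a \<noteq> 0" "b \<noteq> 0" "g \<noteq> 0"
  shows "pm_square (mono3 a b g e f k) \<longleftrightarrow> pm_square (mono3 a b g (e mod 2) (f mod 2) (k mod 2))"
proof -
  have "mono3 a b g e f k =
      (mono3 a b g (e div 2) (f div 2) (k div 2))\<^sup>2 * mono3 a b g (e mod 2) (f mod 2) (k mod 2)"
    by (simp add: mono3_mult mono3_power)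
  moreover have "mono3 a b g (e div 2) (f div 2) (k div 2) \<noteq> 0"
    using assms by (simp add: mono3_def)
  ultimately show ?thesis
    by (simp only: pm_square_mult_square not_False_eq_True)
qed

text \<open>Two shifts by 9 make \<open>q = 2 * t\<close> in \<open>eds9_closed_shift\<close>: the
  sign vanishes and the exponents \<open>q * q\<close> and \<open>q * r\<close> become even;
  \<open>c\<close> carries their halves.\<close>

lemma pm_square_eds9_closed_mod_18:
  assumes "a \<noteq> 0" "b \<noteq> 0" "g \<noteq> 0"
  shows "pm_square (eds9_closed a b g n) \<longleftrightarrow> pm_square (eds9_closed a b g (n mod 18))"
proof -
  define t where "t = n div 18"
  define r where "r = n mod 18"
  define c where "c = mono3 a b g 63 36 27 ^ (2 * t * t) * mono3 a b g 14 8 6 ^ (t * r)"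
  have n: "n = 9 * (2 * t) + r"
    by (simp add: t_def r_def)
  have "eds9_closed a b g n = c\<^sup>2 * eds9_closed a b g r"
    unfolding n eds9_closed_shift c_def by (simp add: power_mult_distrib ac_simps flip: power_mult)
  moreover have "c \<noteq> 0"
    using assms by (simp add: c_def mono3_def)
  ultimately show ?thesis
    by (simp add: pm_square_mult_square r_def)
qed

theorem theorem5p16:
  fixes \<alpha> :: int and n :: nat
  assumes "\<alpha> \<notin> {0, 1}"
    and "n mod 18 \<in> {2, 3, 4, 6, 7, 8, 10, 11, 12, 14, 15, 16}"
  shows "\<not> pm_square (eds9 \<alpha> n)"
proof -
  define b where "b = \<alpha> - 1"
  define g where "g = \<alpha>\<^sup>2 - \<alpha> + 1"
  have g: "\<not> pm_square g"
    using not_pm_square_consecutive [of \<alpha> 1] assms(1) by (simp add: g_def)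
  have ab: "\<not> pm_square (\<alpha> * b)"
    using not_pm_square_consecutive [of \<alpha> 0] assms(1)
    by (simp add: b_def power2_eq_square algebra_simps)
  have "odd g"
    by (simp add: g_def)
  then have nz: "\<alpha> \<noteq> 0" "b \<noteq> 0" "g \<noteq> 0"
    using assms(1) by (auto simp: b_def)
  \<comment> \<open>A common divisor of \<gamma> and of either factor of \<open>\<alpha> * b\<close>
    divides this difference, hence is a unit.\<close>
  have bezout: "g - \<alpha> * b = 1"
    by (simp add: g_def b_def power2_eq_square algebra_simps)
  have unit: "is_unit d" if "d dvd \<alpha> * b" "d dvd g" for d
    using dvd_diff [OF that(2,1)] by (simp only: bezout)
  have "coprime \<alpha> g" "coprime b g"
    by (rule coprimeI, erule unit [OF dvd_mult2] unit [OF dvd_mult], assumption)+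
  then have ag: "\<not> pm_square (\<alpha> * g)" and bg: "\<not> pm_square (b * g)"
    using g pm_square_mult_coprimeD by blast+
  note M = pm_square_mono3 [OF nz]
  \<comment> \<open>Modulo 2 the exponents leave \<open>g\<close> at 4, 14;
    \<open>\<alpha> * b\<close> at 6, 7, 11, 12; \<open>\<alpha> * g\<close> at 8, 10;
    \<open>b * g\<close> at 2, 3, 15, 16.\<close>
  have "\<not> pm_square (eds9_closed \<alpha> b g (n mod 18))"
    using assms(2)
    by (elim insertE)
      (simp_all add: eds9_closed_values, (subst M, simp add: mono3_def g ab ag bg)+)
  then show ?thesis
    using pm_square_eds9_closed_mod_18 [OF nz, of n]
    by (simp only: eds9_eq_closed [OF assms(1)] b_def g_def not_False_eq_True)
qed

end
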